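(* Let $U_1,U_2,\dots$ be i.i.d. almost surely positive random variables distributed as $U$, with tail function $Q(x)=\mathbb{P}(U>x)$. Assume that $\mathbb{E}[U^2]<\infty$ and that there exist $\beta\in(0,1/2)$ and $x_0>0$ in the interior of the support of the distribution of $U$ such that $Q^{1/2-\beta}$ is convex on $[x_0,\infty)$. For each $N$, let $V_1\le\dots\le V_N$ be the order statistics of $(U_1,\dots,U_N)$, and, conditionally on $(V_1,\dots,V_N)$, let $(X_{i,j})_{1\le i<j\le N}$ be independent Bernoulli variables with $\mathbb{P}(X_{i,j}=1\mid V_1,\dots,V_N)=\frac{V_i}{V_i+V_j}$; set $X_{j,i}=1-X_{i,j}$ and $S_i=\sum_{j\neq i}X_{i,j}$. Then, with $\mathbb{P}$ the annealed probability (over both the $U_k$ and the $X_{i,j}$), \[\mathbb{P}(\text{player } N \text{ wins})\ \ge\ \mathbb{P}\Big(S_N>\max_{1\le i\le N-1}S_i\Big)\xrightarrow[N\to\infty]{}1,\] where "player $N$ wins" means that $S_N=\max_{1\le i\le N}S_i$.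
   Context: This is the Bradley–Terry model in random environment: $N$ players face each other once; $X_{i,j}=1$ means player $i$ beats player $j$; $S_i$ is the number of victories (score) of player $i$; a winner is any player with the highest score. Player $i$ has strength $V_i$, the $i$-th smallest of $U_1,\dots,U_N$. *)

theory Defs
  imports "HOL-Probability.Probability"
begin

definition tail :: "real measure \<Rightarrow> real \<Rightarrow> real" where
  "tail D x = measure D {x<..}"

definition dist_support :: "real measure \<Rightarrow> real set" where
  "dist_support D = {x. \<forall>e>0. measure D (ball x e) > 0}"

definition order_stat :: "nat \<Rightarrow> (nat \<Rightarrow> real) \<Rightarrow> nat \<Rightarrow> real" where
  "order_stat N u k = sort (map u [1..<N+1]) ! (k - 1)"

definition tournament :: "nat \<Rightarrow> (nat \<Rightarrow> real) \<Rightarrow> (nat \<times> nat \<Rightarrow> bool) pmf" where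
  "tournament N v = Pi_pmf {(i,j). 1 \<le> i \<and> i < j \<and> j \<le> N} False
      (\<lambda>(i,j). bernoulli_pmf (v i / (v i + v j)))"

definition beats :: "(nat \<times> nat \<Rightarrow> bool) \<Rightarrow> nat \<Rightarrow> nat \<Rightarrow> bool" where
  "beats x i j = (if i < j then x (i,j) else if j < i then \<not> x (j,i) else False)"

definition score :: "nat \<Rightarrow> (nat \<times> nat \<Rightarrow> bool) \<Rightarrow> nat \<Rightarrow> nat" where
  "score N x i = card {j \<in> {1..N}. j \<noteq> i \<and> beats x i j}"

definition annealed :: "real measure \<Rightarrow> nat \<Rightarrow> ((nat \<times> nat \<Rightarrow> bool) \<Rightarrow> bool) \<Rightarrow> real" where
  "annealed D N E = (\<integral>u. measure_pmf.prob (tournament N (order_stat N u)) {x. E x}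
                        \<partial>(PiM {1..N} (\<lambda>_. D)))"

end

theory Submission
  imports Defs "HOL-Real_Asymp.Real_Asymp"
begin

text \<open>
  Given strengths \<open>v\<close>, Chernoff's bound with the weight \<open>sqrt (v N / v i)\<close> per point of
  \<open>score i - score N\<close> gives that player \<open>i\<close> reaches the score of player \<open>N\<close> with probability at most
  the exponential of minus the sum over \<open>j\<close> of
  \<open>v j * (sqrt (v N) - sqrt (v i))\<^sup>2 / ((v i + v j) * (v N + v j))\<close>.
  A positive fraction of the \<open>v j\<close> is bounded below, so if \<open>v i \<le> v N - d\<close> this sum is at least
  of order \<open>N * d\<^sup>2 / (v N) ^ 3\<close>.

  Write \<open>\<gamma> = 1/2 - \<beta>\<close>. Convexity of \<open>Q powr \<gamma>\<close> between a multiple of \<open>v N\<close> and \<open>v N\<close>, together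
  with \<open>Q x = O(1 / x\<^sup>2)\<close>, shows that with high probability no other strength is within
  \<open>d = \<kappa> * (v N)\<^sup>2 powr \<gamma> / N powr \<gamma> * v N\<close> of the largest one. Since the second moment also gives
  \<open>v N \<le> sqrt N\<close> with high probability, the exponent grows at least like a positive power of \<open>N\<close>,
  which beats the union bound over the \<open>N - 1\<close> competitors.
\<close>

subsection \<open>Scores for fixed strengths\<close>

definition pairs :: "nat \<Rightarrow> (nat \<times> nat) set" where
  "pairs N = {(a,b). 1 \<le> a \<and> a < b \<and> b \<le> N}"

lemma finite_pairs [simp]: "finite (pairs N)"
  by (rule finite_subset[of _ "{1..N} \<times> {1..N}"]) (auto simp: pairs_def)

text \<open>Every game contributes the weight of its winner exactly once, so grouping the games by
  winner collects one factor \<open>w k\<close> per victory of \<open>k\<close>. The left side is a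
  product over games, which is the form that independence can exploit.\<close>

lemma prod_winner_eq_prod_power_score:
  fixes w :: "nat \<Rightarrow> 'a :: comm_monoid_mult"
  shows "(\<Prod>e\<in>pairs N. if x e then w (fst e) else w (snd e)) = (\<Prod>k\<in>{1..N}. w k ^ score N x k)"
proof -
  have "(\<Prod>k\<in>{1..N}. w k ^ score N x k) = (\<Prod>k\<in>{1..N}. \<Prod>j\<in>{j\<in>{1..N}. j \<noteq> k \<and> beats x k j}. w k)"
    by (simp add: score_def)
  also have "\<dots> = (\<Prod>(k,j)\<in>(SIGMA k:{1..N}. {j\<in>{1..N}. j \<noteq> k \<and> beats x k j}). w k)"
    by (rule prod.Sigma) auto
  \<comment> \<open>A victory of \<open>k\<close> over \<open>j\<close> corresponds to the game
    stored at the sorted pair; conversely a game is turned around exactly when its second entry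
    won.\<close>
  also have "\<dots> = (\<Prod>e\<in>pairs N. if x e then w (fst e) else w (snd e))"
    by (rule prod.reindex_bij_witness[where i="\<lambda>e. if x e then e else (snd e, fst e)"
          and j="\<lambda>(k,j). (min k j, max k j)"])
       (auto simp: pairs_def beats_def min_def max_def split: if_splits)
  finally show ?thesis ..
qed

text \<open>The games are independent, so the joint generating function of the scores factors over
  games; each factor averages the two possible winner weights.\<close>

lemma expectation_prod_power_score:
  fixes v w :: "nat \<Rightarrow> real"
  assumes "\<And>k. k \<in> {1..N} \<Longrightarrow> v k > 0" and "\<And>k. w k \<ge> 0"
  shows "measure_pmf.expectation (tournament N v) (\<lambda>x. \<Prod>k\<in>{1..N}. w k ^ score N x k)
       = (\<Prod>(a,b)\<in>pairs N. (w a * v a + w b * v b) / (v a + v b))"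
proof -
  have "measure_pmf.expectation (tournament N v) (\<lambda>x. \<Prod>k\<in>{1..N}. w k ^ score N x k)
      = measure_pmf.expectation (Pi_pmf (pairs N) False (\<lambda>(a,b). bernoulli_pmf (v a / (v a + v b))))
          (\<lambda>x. \<Prod>e\<in>pairs N. (\<lambda>e y. if y then w (fst e) else w (snd e)) e (x e))"
    by (simp only: prod_winner_eq_prod_power_score tournament_def pairs_def[symmetric])
  also have "\<dots> = (\<Prod>e\<in>pairs N. measure_pmf.expectation ((\<lambda>(a,b). bernoulli_pmf (v a / (v a + v b))) e)
          (\<lambda>y. if y then w (fst e) else w (snd e)))"
    by (rule expectation_prod_Pi_pmf) (auto intro: integrable_measure_pmf_finite simp: assms(2))
  also have "\<dots> = (\<Prod>(a,b)\<in>pairs N. (w a * v a + w b * v b) / (v a + v b))"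
  proof (rule prod.cong[OF refl], clarify)
    fix a b assume "(a,b) \<in> pairs N"
    then have "v a > 0" "v b > 0" using assms by (auto simp: pairs_def)
    moreover from this have "1 - v a / (v a + v b) = v b / (v a + v b)" by (simp add: field_simps)
    ultimately show "measure_pmf.expectation (bernoulli_pmf (v a / (v a + v b)))
          (\<lambda>y. if y then w (fst (a,b)) else w (snd (a,b))) = (w a * v a + w b * v b) / (v a + v b)"
      by (subst integral_bernoulli_pmf) (auto simp: add_divide_distrib mult.commute)
  qed
  finally show ?thesis .
qed

text \<open>The Chernoff weights make \<open>w i * v i\<close> and \<open>w N * v N\<close> both equal to the geometric mean of
  \<open>v i\<close> and \<open>v N\<close>, which is optimal simultaneously for all opponents \<open>j\<close>.\<close>

lemma prob_score_le_le_exp: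
  fixes v :: "nat \<Rightarrow> real"
  assumes pos: "\<And>k. k \<in> {1..N} \<Longrightarrow> v k > 0"
    and im: "1 \<le> i" "i < N" and le: "v i \<le> v N"
  shows "measure_pmf.prob (tournament N v) {x. score N x N \<le> score N x i}
    \<le> exp (- (\<Sum>j\<in>{1..N} - {i,N}. v j * (sqrt (v N) - sqrt (v i))\<^sup>2 / ((v i + v j) * (v N + v j))))"
proof -
  let ?J = "{1..N} - {i,N}"
  define s where "s = sqrt (v i * v N)"
  define z where "z = s / v i"
  define w where "w = (\<lambda>k. if k = i then z else if k = N then inverse z else 1)"
  have pi: "v i > 0" and pN: "v N > 0" using pos im by auto
  have s2: "s * s = v i * v N" using pi pN by (simp add: s_def)
  have s0: "s > 0" using pi pN by (simp add: s_def)
  have "v i * v i \<le> v i * v N" using pi le by simp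
  then have "v i \<le> s" unfolding s_def using pi by (intro real_le_rsqrt) (simp add: power2_eq_square)
  then have z1: "z \<ge> 1" using pi by (simp add: z_def)
  have wi: "w i * v i = s" using pi by (simp add: w_def z_def)
  have wN: "w N * v N = s" using im pi s2 s0 by (simp add: w_def z_def field_simps)
  have wj: "w j = 1" if "j \<in> ?J" for j using that by (auto simp: w_def)
  have N1: "{1..N} = insert i (insert N ?J)" using im by auto
  \<comment> \<open>All other weights are 1, so what remains is z to the power
    \<open>score N x i\<close> minus \<open>score N x N\<close>. As \<open>z \<ge> 1\<close>, this
    is at least 1 on the event in question, which is the Markov step below.\<close>
  have prodw: "(\<Prod>k\<in>{1..N}. w k ^ score N x k) = z ^ score N x i * inverse z ^ score N x N" for x
    using im by (subst N1) (simp add: wj prod.neutral w_def)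
  let ?F = "\<lambda>x. \<Prod>k\<in>{1..N}. w k ^ score N x k"
  let ?h = "\<lambda>(a,b). (w a * v a + w b * v b) / (v a + v b)"
  \<comment> \<open>These list the games of \<open>i\<close> and of \<open>N\<close> against a third
    player. Games are stored with the smaller index first: the position of \<open>i\<close> depends
    on \<open>j\<close>, whereas \<open>N\<close>, the largest index, always comes second.\<close>
  let ?f = "\<lambda>j. (min i j, max i j)" and ?g = "\<lambda>j. (j, N)"
  have fin: "finite (set_pmf (tournament N v))"
    unfolding tournament_def pairs_def[symmetric]
    by (rule finite_subset[OF set_Pi_pmf_subset']) (auto intro: finite_pairs)
  have "measure_pmf.prob (tournament N v) {x. score N x N \<le> score N x i}
      = measure_pmf.expectation (tournament N v) (indicator {x. score N x N \<le> score N x i})"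
    by simp
  also have "\<dots> \<le> measure_pmf.expectation (tournament N v) ?F"
  proof (rule integral_mono)
    fix x
    have "1 \<le> z ^ score N x i * inverse z ^ score N x N" if "score N x N \<le> score N x i"
      using z1 power_increasing[OF that z1] by (simp add: power_inverse field_simps)
    then show "indicator {x. score N x N \<le> score N x i} x \<le> ?F x"
      unfolding prodw using z1 by (auto simp: indicator_def)
  qed (use fin in \<open>auto intro: integrable_measure_pmf_finite\<close>)
  also have "\<dots> = prod ?h (pairs N)"
    by (rule expectation_prod_power_score) (use pos z1 in \<open>auto simp: w_def\<close>)
  \<comment> \<open>A game that involves neither \<open>i\<close> nor \<open>N\<close> has both
    weights equal to 1 and hence factor 1.\<close>
  also have "\<dots> = prod ?h (?f ` ?J \<union> ?g ` ?J \<union> {(i,N)})"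
  proof (rule prod.mono_neutral_right)
    show "?f ` ?J \<union> ?g ` ?J \<union> {(i,N)} \<subseteq> pairs N"
      using im by (auto simp: pairs_def min_def max_def)
    show "\<forall>e\<in>pairs N - (?f ` ?J \<union> ?g ` ?J \<union> {(i,N)}). ?h e = 1"
    proof
      fix e assume "e \<in> pairs N - (?f ` ?J \<union> ?g ` ?J \<union> {(i,N)})"
      then obtain a b where ab: "e = (a,b)"
        and e: "(a,b) \<in> pairs N" "(a,b) \<notin> ?f ` ?J \<union> ?g ` ?J \<union> {(i,N)}"
        by (cases e) auto
      have "a \<noteq> i"
      proof
        assume "a = i"
        with e have "(a,b) = ?f b" "b \<in> ?J" by (auto simp: pairs_def)
        with e show False by blast
      qed
      moreover have "b \<noteq> i"
      proof
        assume "b = i"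
        with e im have "(a,b) = ?f a" "a \<in> ?J" by (auto simp: pairs_def)
        with e show False by blast
      qed
      moreover have "b \<noteq> N" using e \<open>a \<noteq> i\<close> by (auto simp: pairs_def)
      moreover have "a \<noteq> N" using e by (auto simp: pairs_def)
      moreover have "v a > 0" "v b > 0" using e pos by (auto simp: pairs_def)
      ultimately show "?h e = 1" by (simp add: ab w_def)
    qed
  qed auto
  also have "\<dots> = prod ?h (?f ` ?J) * prod ?h (?g ` ?J) * ?h (i,N)"
  proof -
    have "prod ?h (?f ` ?J \<union> ?g ` ?J \<union> {(i,N)}) = prod ?h (?f ` ?J \<union> ?g ` ?J) * prod ?h {(i,N)}"
      using im by (intro prod.union_disjoint) (auto simp: min_def max_def split: if_splits)
    also have "prod ?h (?f ` ?J \<union> ?g ` ?J) = prod ?h (?f ` ?J) * prod ?h (?g ` ?J)"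
      using im by (intro prod.union_disjoint) (auto simp: min_def max_def split: if_splits)
    finally show ?thesis by simp
  qed
  also have "prod ?h (?f ` ?J) = (\<Prod>j\<in>?J. (s + v j) / (v i + v j))"
  proof (subst prod.reindex)
    show "inj_on ?f ?J" by (auto simp: inj_on_def min_def max_def split: if_splits)
    show "prod (?h \<circ> ?f) ?J = (\<Prod>j\<in>?J. (s + v j) / (v i + v j))"
      by (intro prod.cong) (auto simp: min_def max_def wi wj add.commute)
  qed
  also have "prod ?h (?g ` ?J) = (\<Prod>j\<in>?J. (s + v j) / (v N + v j))"
  proof (subst prod.reindex)
    show "inj_on ?g ?J" by (auto simp: inj_on_def)
    show "prod (?h \<circ> ?g) ?J = (\<Prod>j\<in>?J. (s + v j) / (v N + v j))"
      by (intro prod.cong) (auto simp: wN wj add.commute)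
  qed
  \<comment> \<open>The direct game between \<open>i\<close> and \<open>N\<close> has factor 2s /
    (\<open>v i + v N\<close>), at most 1 because the geometric mean is at most the arithmetic mean.
    It is simply dropped.\<close>
  also have "(\<Prod>j\<in>?J. (s + v j) / (v i + v j)) * (\<Prod>j\<in>?J. (s + v j) / (v N + v j)) * ?h (i,N)
     \<le> (\<Prod>j\<in>?J. (s + v j) / (v i + v j)) * (\<Prod>j\<in>?J. (s + v j) / (v N + v j)) * 1"
  proof (rule mult_left_mono)
    have "0 \<le> (sqrt (v i) - sqrt (v N))\<^sup>2" by simp
    then have "2 * s \<le> v i + v N" using pi pN by (simp add: power2_diff s_def real_sqrt_mult)
    then show "?h (i,N) \<le> 1" using pi pN by (simp add: wi wN)
    show "0 \<le> (\<Prod>j\<in>?J. (s + v j) / (v i + v j)) * (\<Prod>j\<in>?J. (s + v j) / (v N + v j))"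
      using s0 pi pN pos by (intro mult_nonneg_nonneg prod_nonneg) (auto intro!: divide_nonneg_nonneg add_nonneg_nonneg simp: less_imp_le)
  qed
  also have "\<dots> = (\<Prod>j\<in>?J. (s + v j)\<^sup>2 / ((v i + v j) * (v N + v j)))"
    by (simp add: prod.distrib[symmetric] power2_eq_square)
  also have "\<dots> \<le> (\<Prod>j\<in>?J. exp (- (v j * (sqrt (v N) - sqrt (v i))\<^sup>2 / ((v i + v j) * (v N + v j)))))"
  proof (rule prod_mono, rule conjI)
    fix j assume "j \<in> ?J"
    then have pj: "v j > 0" using pos by auto
    then show "0 \<le> (s + v j)\<^sup>2 / ((v i + v j) * (v N + v j))" using pi pN by simp
    \<comment> \<open>Since \<open>s * s = v i * v N\<close>, the two factors belonging to
      \<open>j\<close> multiply to 1 - y with y the summand of the exponent, and 1 - y is at most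
      exp(-y).\<close>
    have "(v i + v j) * (v N + v j) - v j * (sqrt (v N) - sqrt (v i))\<^sup>2 = (s + v j)\<^sup>2"
      using s2 pi pN by (simp add: power2_diff power2_sum algebra_simps s_def real_sqrt_mult power2_eq_square)
    then have "(s + v j)\<^sup>2 / ((v i + v j) * (v N + v j))
        = 1 + - (v j * (sqrt (v N) - sqrt (v i))\<^sup>2 / ((v i + v j) * (v N + v j)))"
      using pj pi pN unfolding \<open>_ = (s + v j)\<^sup>2\<close>[symmetric] diff_divide_distrib by simp
    then show "(s + v j)\<^sup>2 / ((v i + v j) * (v N + v j))
       \<le> exp (- (v j * (sqrt (v N) - sqrt (v i))\<^sup>2 / ((v i + v j) * (v N + v j))))"
      by (metis exp_ge_add_one_self)
  qed
  also have "\<dots> = exp (- (\<Sum>j\<in>?J. v j * (sqrt (v N) - sqrt (v i))\<^sup>2 / ((v i + v j) * (v N + v j))))"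
    by (simp add: exp_sum sum_negf[symmetric])
  finally show ?thesis .
qed

text \<open>Union bound over the competitors. The gap \<open>d\<close> forces the square roots to
  differ by at least d / (2 sqrt(\<open>v N\<close>)), each denominator is at most (2
  \<open>v N\<close>)^2, and only opponents stronger than \<open>a\<close> are kept. Each of these
  contributes at least a d^2 / (16 \<open>v N\<close>^3).\<close>

lemma prob_strongest_wins_ge:
  fixes v :: "nat \<Rightarrow> real"
  assumes pos: "\<And>k. k \<in> {1..N} \<Longrightarrow> v k > 0" and N: "N \<ge> 1"
    and gap: "\<And>i. i \<in> {1..<N} \<Longrightarrow> v i \<le> v N - d" and d: "0 \<le> d" and a: "0 \<le> a"
    and big: "real (card {j\<in>{1..N}. v j > a}) \<ge> C"
  shows "measure_pmf.prob (tournament N v) {x. \<forall>i\<in>{1..<N}. score N x i < score N x N}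
     \<ge> 1 - real N * exp (- (a * (C - 2) * d\<^sup>2 / (16 * v N ^ 3)))"
proof -
  define b where "b = a * (C - 2) * d\<^sup>2 / (16 * v N ^ 3)"
  let ?P = "measure_pmf.prob (tournament N v)"
  have pN: "v N > 0" using pos N by auto
  have each: "?P {x. score N x N \<le> score N x i} \<le> exp (- b)" if i: "i \<in> {1..<N}" for i
  proof -
    have le: "v i \<le> v N - d" using gap i by auto
    have pi: "v i > 0" using pos i by auto
    have vi: "v i \<le> v N" using le d by simp
    define D where "D = (sqrt (v N) - sqrt (v i))\<^sup>2"
    have D: "d\<^sup>2 / (4 * v N) \<le> D"
    proof -
      have "d \<le> (sqrt (v N) - sqrt (v i)) * (sqrt (v N) + sqrt (v i))"
        using le pi pN by (simp add: algebra_simps)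
      also have "\<dots> \<le> (sqrt (v N) - sqrt (v i)) * (2 * sqrt (v N))"
        using vi by (intro mult_left_mono) auto
      finally have "d\<^sup>2 \<le> ((sqrt (v N) - sqrt (v i)) * (2 * sqrt (v N)))\<^sup>2"
        using d by (intro power_mono)
      also have "\<dots> = D * (4 * v N)" using pN by (simp add: D_def power_mult_distrib)
      finally show ?thesis using pN by (simp add: field_simps)
    qed
    let ?J = "{1..N} - {i,N}"
    let ?t = "\<lambda>j. v j * D / ((v i + v j) * (v N + v j))"
    let ?T = "{j\<in>{1..N}. v j > a} - {i,N}"
    have t0: "0 \<le> ?t j" if "j \<in> ?J" for j
      using pos[of j] that pi pN by (simp add: D_def)
    have tT: "a * d\<^sup>2 / (16 * v N ^ 3) \<le> ?t j" if j: "j \<in> ?T" for j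
    proof -
      have pj: "v j > 0" using pos j by auto
      have vj: "v j \<le> v N" using gap[of j] d j by auto
      then have "(v i + v j) * (v N + v j) \<le> (2 * v N) * (2 * v N)"
        using vi pi pj pN by (intro mult_mono) auto
      then have "(a * (d\<^sup>2 / (4 * v N))) / ((2 * v N) * (2 * v N)) \<le> ?t j"
        using D a j pi pj pN vi vj by (intro frac_le mult_mono) (auto simp: D_def)
      then show ?thesis by (simp add: power3_eq_cube mult_ac)
    qed
    have "b \<le> real (card ?T) * (a * d\<^sup>2 / (16 * v N ^ 3))"
    proof -
      \<comment> \<open>The loss of 2 in \<open>C - 2\<close> comes from excluding \<open>i\<close>
        and \<open>N\<close> as opponents.\<close>
      have "card {j\<in>{1..N}. v j > a} - card {i,N} \<le> card ?T"
        by (rule diff_card_le_card_Diff) simp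
      then have "C - 2 \<le> real (card ?T)" using big i by auto
      then have "(C - 2) * (a * d\<^sup>2 / (16 * v N ^ 3)) \<le> real (card ?T) * (a * d\<^sup>2 / (16 * v N ^ 3))"
        using a pN by (intro mult_right_mono) auto
      then show ?thesis by (simp add: b_def mult_ac)
    qed
    also have "\<dots> \<le> (\<Sum>j\<in>?T. ?t j)"
      using tT by (intro sum_bounded_below) auto
    also have "\<dots> \<le> (\<Sum>j\<in>?J. ?t j)"
      using t0 by (intro sum_mono2) auto
    finally have "exp (- (\<Sum>j\<in>?J. ?t j)) \<le> exp (- b)" by simp
    moreover have "?P {x. score N x N \<le> score N x i} \<le> exp (- (\<Sum>j\<in>?J. ?t j))"
      unfolding D_def using i vi pos by (intro prob_score_le_le_exp) auto
    ultimately show ?thesis by (rule order_trans[rotated])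
  qed
  let ?G = "{x. \<forall>i\<in>{1..<N}. score N x i < score N x N}"
  have "?P (UNIV - ?G) \<le> ?P (\<Union>i\<in>{1..<N}. {x. score N x N \<le> score N x i})"
    by (intro measure_pmf.finite_measure_mono) (auto simp: not_less)
  also have "\<dots> \<le> (\<Sum>i\<in>{1..<N}. ?P {x. score N x N \<le> score N x i})"
    by (intro measure_pmf.finite_measure_subadditive_finite) auto
  also have "\<dots> \<le> (\<Sum>i\<in>{1..<N}. exp (- b))" by (intro sum_mono each)
  also have "\<dots> \<le> real N * exp (- b)" by simp
  finally have "?P (UNIV - ?G) \<le> real N * exp (- b)" .
  moreover have "?P (UNIV - ?G) = 1 - ?P ?G"
    using measure_pmf.prob_compl[of ?G "tournament N v"] by simp
  ultimately show ?thesis by (simp add: b_def)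
qed

subsection \<open>Order statistics\<close>

text \<open>Sorting permutes the list; the shifts by one translate between list positions from 0 and
  player numbers from 1. The bijection lets properties of the sample be transferred to the ranked
  players, with ties handled through distinct indices.\<close>

lemma order_stat_bij:
  "\<exists>\<pi>. bij_betw \<pi> {1..N} {1..N} \<and> (\<forall>k\<in>{1..N}. order_stat N u k = u (\<pi> k))"
proof -
  let ?xs = "map u [1..<N+1]"
  have "mset (sort ?xs) = mset ?xs" by simp
  then obtain p where p: "p permutes {..<length ?xs}" "permute_list p ?xs = sort ?xs"
    by (rule mset_eq_permutation)
  then have p': "p permutes {..<N}" by (simp del: upt_Suc)
  define \<pi> where "\<pi> k = Suc (p (k - 1))" for k
  have "bij_betw \<pi> {1..N} {1..N}"
  proof -
    have "bij_betw (\<lambda>k. k - 1) {1..N} {..<N}"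
      by (rule bij_betwI[where g=Suc]) auto
    moreover have "bij_betw p {..<N} {..<N}" using p' by (rule permutes_imp_bij)
    moreover have "bij_betw Suc {..<N} {1..N}"
      by (rule bij_betwI[where g="\<lambda>k. k - 1"]) auto
    ultimately have "bij_betw (Suc \<circ> (p \<circ> (\<lambda>k. k - 1))) {1..N} {1..N}"
      by (blast intro: bij_betw_trans)
    then show ?thesis by (simp add: \<pi>_def[abs_def] comp_def)
  qed
  moreover have "order_stat N u k = u (\<pi> k)" if "k \<in> {1..N}" for k
  proof -
    have k: "k - 1 < N" using that by auto
    then have pk: "p (k - 1) < N" using permutes_in_image[OF p'] by auto
    have "order_stat N u k = permute_list p ?xs ! (k - 1)"
      by (simp only: order_stat_def p(2))
    also have "\<dots> = ?xs ! p (k - 1)"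
      using k p(1) by (subst permute_list_nth) (auto simp del: upt_Suc)
    also have "\<dots> = u (\<pi> k)" using pk by (simp add: \<pi>_def del: upt_Suc)
    finally show ?thesis .
  qed
  ultimately show ?thesis by blast
qed

lemma order_stat_mono:
  assumes "1 \<le> i" "i \<le> j" "j \<le> N"
  shows "order_stat N u i \<le> order_stat N u j"
  unfolding order_stat_def using assms by (intro sorted_nth_mono) auto

lemma card_order_stat:
  "card {k\<in>{1..N}. P (order_stat N u k)} = card {j\<in>{1..N}. P (u j)}"
proof -
  obtain \<pi> where b: "bij_betw \<pi> {1..N} {1..N}" and e: "\<And>k. k \<in> {1..N} \<Longrightarrow> order_stat N u k = u (\<pi> k)"
    using order_stat_bij by blast
  have "bij_betw \<pi> {k\<in>{1..N}. P (order_stat N u k)} {j\<in>{1..N}. P (u j)}"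
    unfolding bij_betw_def
  proof
    show "inj_on \<pi> {k\<in>{1..N}. P (order_stat N u k)}"
      by (rule inj_on_subset[OF bij_betw_imp_inj_on[OF b]]) auto
    show "\<pi> ` {k \<in> {1..N}. P (order_stat N u k)} = {j \<in> {1..N}. P (u j)}" (is "?L = ?R")
    proof
      show "?L \<subseteq> ?R" using bij_betwE[OF b] e by (auto simp del: atLeastAtMost_iff)
      show "?R \<subseteq> ?L"
      proof
        fix j assume j: "j \<in> ?R"
        then obtain k where "k \<in> {1..N}" "j = \<pi> k" using bij_betw_imp_surj_on[OF b] by blast
        with j have "P (order_stat N u k)" using e[of k] by simp
        with \<open>k \<in> {1..N}\<close> \<open>j = \<pi> k\<close> show "j \<in> ?L" by simp
      qed
    qed
  qed
  then show ?thesis by (rule bij_betw_same_card)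
qed

text \<open>Turns a statement about a sorted list into a count of sample points, which is a sum of
  indicators. This is how order statistics are shown to be measurable.\<close>

lemma order_stat_le_iff:
  assumes k: "k \<in> {1..N}"
  shows "order_stat N u k \<le> x \<longleftrightarrow> k \<le> card {j\<in>{1..N}. u j \<le> x}"
proof (subst card_order_stat[where P="\<lambda>y. y \<le> x", symmetric], rule iffI)
  assume "order_stat N u k \<le> x"
  then have "{1..k} \<subseteq> {j\<in>{1..N}. order_stat N u j \<le> x}"
    using k by (auto intro: order_trans[OF order_stat_mono[of _ k N u]])
  from card_mono[OF _ this] show "k \<le> card {j\<in>{1..N}. order_stat N u j \<le> x}" by simp
next
  assume c: "k \<le> card {j\<in>{1..N}. order_stat N u j \<le> x}"
  show "order_stat N u k \<le> x"
  proof (rule ccontr)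
    assume n: "\<not> order_stat N u k \<le> x"
    have "{j\<in>{1..N}. order_stat N u j \<le> x} \<subseteq> {1..<k}"
    proof
      fix j assume j: "j \<in> {j\<in>{1..N}. order_stat N u j \<le> x}"
      with n k order_stat_mono[of k j N u] have "\<not> k \<le> j" by auto
      with j show "j \<in> {1..<k}" by auto
    qed
    from card_mono[OF _ this] c k show False by auto
  qed
qed

lemma order_stat_measurable [measurable]:
  assumes "sets D = sets borel" and k: "k \<in> {1..N}"
  shows "(\<lambda>u. order_stat N u k) \<in> borel_measurable (PiM {1..N} (\<lambda>_. D))"
proof (rule borel_measurableI_le)
  fix x :: real
  have m: "(\<lambda>u. u j) \<in> borel_measurable (PiM {1..N} (\<lambda>_. D))" if "j \<in> {1..N}" for j
    using that measurable_component_singleton[of j "{1..N}" "\<lambda>_. D"]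
    by (simp add: measurable_cong_sets[OF refl assms(1)])
  have c: "real (card {j\<in>{1..N}. u j \<le> x}) = (\<Sum>j\<in>{1..N}. indicator {..x} (u j))" for u
    by (simp add: indicator_def sum.If_cases Int_def)
  have iff: "order_stat N u k \<le> x \<longleftrightarrow> real k \<le> (\<Sum>j\<in>{1..N}. indicator {..x} (u j))" for u
    by (simp only: order_stat_le_iff[OF k] c[symmetric] of_nat_le_iff)
  have "{u \<in> space (PiM {1..N} (\<lambda>_. D)). order_stat N u k \<le> x}
     = {u \<in> space (PiM {1..N} (\<lambda>_. D)). real k \<le> (\<Sum>j\<in>{1..N}. indicator {..x} (u j))}"
    by (simp only: iff)
  also have "\<dots> \<in> sets (PiM {1..N} (\<lambda>_. D))"
  proof -
    have [measurable]: "(\<lambda>u. \<Sum>j\<in>{1..N}. indicator {..x} (u j) :: real) \<in> borel_measurable (PiM {1..N} (\<lambda>_. D))"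
      by (intro borel_measurable_sum measurable_compose[OF m]) auto
    show ?thesis by measurable
  qed
  finally show "{u \<in> space (PiM {1..N} (\<lambda>_. D)). order_stat N u k \<le> x} \<in> sets (PiM {1..N} (\<lambda>_. D))" .
qed

text \<open>Only finitely many tournament outcomes are possible, so the probability is a finite sum
  of products of measurable functions of the order statistics.\<close>

lemma prob_tournament_measurable:
  assumes "sets D = sets borel"
  shows "(\<lambda>u. measure_pmf.prob (tournament N (order_stat N u)) A) \<in> borel_measurable (PiM {1..N} (\<lambda>_. D))"
proof -
  let ?F = "PiE_dflt (pairs N) False (\<lambda>_. UNIV)"
  have finF: "finite ?F" by auto
  \<comment> \<open>\<open>bernoulli_pmf\<close> clamps its parameter to [0,1]. Keeping the clamp
    makes the formula valid for every real \<open>v\<close>, including samples with nonpositive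
    entries.\<close>
  have eq: "measure_pmf.prob (tournament N v) A = (\<Sum>x\<in>A \<inter> ?F. \<Prod>(a,b)\<in>pairs N.
      (\<lambda>p. if x (a,b) then p else 1 - p) (min 1 (max 0 (v a / (v a + v b)))))" for v
  proof -
    have "set_pmf (tournament N v) \<subseteq> ?F"
      unfolding tournament_def pairs_def[symmetric]
      by (rule order_trans[OF set_Pi_pmf_subset']) (auto simp: PiE_dflt_def)
    then have "A \<inter> set_pmf (tournament N v) = A \<inter> ?F \<inter> set_pmf (tournament N v)" by blast
    then have "measure_pmf.prob (tournament N v) A = measure_pmf.prob (tournament N v) (A \<inter> ?F)"
      by (metis measure_Int_set_pmf)
    also have "\<dots> = (\<Sum>x\<in>A \<inter> ?F. pmf (tournament N v) x)"
      using finF by (intro measure_measure_pmf_finite) auto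
    also have "\<dots> = (\<Sum>x\<in>A \<inter> ?F. \<Prod>(a,b)\<in>pairs N.
      (\<lambda>p. if x (a,b) then p else 1 - p) (min 1 (max 0 (v a / (v a + v b)))))"
      unfolding tournament_def pairs_def[symmetric]
      by (intro sum.cong refl, subst pmf_Pi')
         (auto simp: PiE_dflt_def bernoulli_pmf.rep_eq intro!: prod.cong)
    finally show ?thesis .
  qed
  show ?thesis unfolding eq
  proof (intro borel_measurable_sum borel_measurable_prod, clarify)
    fix x :: "nat \<times> nat \<Rightarrow> bool" and a b assume "(a,b) \<in> pairs N"
    then have [measurable]: "(\<lambda>u. order_stat N u a) \<in> borel_measurable (PiM {1..N} (\<lambda>_. D))"
       "(\<lambda>u. order_stat N u b) \<in> borel_measurable (PiM {1..N} (\<lambda>_. D))"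
      using order_stat_measurable[OF assms] by (auto simp: pairs_def)
    show "(\<lambda>u. (\<lambda>p. if x (a,b) then p else 1 - p) (min 1 (max 0
        (order_stat N u a / (order_stat N u a + order_stat N u b))))) \<in> borel_measurable (PiM {1..N} (\<lambda>_. D))"
      by measurable
  qed
qed

subsection \<open>The tail function\<close>

context real_distribution
begin

lemma tail_antimono: "x \<le> y \<Longrightarrow> tail M y \<le> tail M x"
  unfolding tail_def by (intro finite_measure_mono) auto

lemma tail_nonneg: "0 \<le> tail M x"
  by (simp add: tail_def)

lemma prob_Ioc_eq_tail_diff: "a \<le> b \<Longrightarrow> prob {a<..b} = tail M a - tail M b"
proof -
  assume "a \<le> b"
  then have "{a<..} = {a<..b} \<union> {b<..}" by auto
  then have "tail M a = prob {a<..b} + tail M b"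
    unfolding tail_def by (simp add: finite_measure_Union ivl_disj_int)
  then show ?thesis by simp
qed

lemma prob_atMost_eq_tail: "prob {..q} = 1 - tail M q"
proof -
  have "prob {..q} = prob (space M - {q<..})" by (rule arg_cong[where f=prob]) auto
  also have "\<dots> = 1 - tail M q" unfolding tail_def by (rule prob_compl) simp
  finally show ?thesis .
qed

section \<open>Decay of the tail from the second moment\<close>

lemma mult_tail_le_second_moment:
  assumes int: "integrable M (\<lambda>u. u\<^sup>2)" and y: "0 \<le> y"
  shows "y\<^sup>2 * tail M y \<le> (\<integral>u. u\<^sup>2 * indicator {y<..} u \<partial>M)"
proof -
  have "y\<^sup>2 * tail M y = (\<integral>u. y\<^sup>2 * indicator {y<..} u \<partial>M)"
    by (simp add: tail_def)
  also have "\<dots> \<le> (\<integral>u. u\<^sup>2 * indicator {y<..} u \<partial>M)"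
    using y by (intro integral_mono integrable_real_mult_indicator int)
      (auto simp: indicator_def intro: power_mono)
  finally show ?thesis .
qed

lemma tail_le_second_moment:
  assumes int: "integrable M (\<lambda>u. u\<^sup>2)" and y: "0 < y"
  shows "tail M y \<le> (\<integral>u. u\<^sup>2 \<partial>M) / y\<^sup>2"
proof -
  have "(\<integral>u. u\<^sup>2 * indicator {y<..} u \<partial>M) \<le> (\<integral>u. u\<^sup>2 \<partial>M)"
    by (intro integral_mono int integrable_real_mult_indicator) (auto simp: indicator_def)
  with mult_tail_le_second_moment[OF int, of y] y show ?thesis by (simp add: field_simps)
qed

text \<open>Markov's inequality with the truncated second moment, which vanishes by dominated
  convergence. The untruncated bound would only give O(1); the limit 0 is what puts the maximum of
  the sample below sqrt(N) with high probability.\<close>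

lemma mult_tail_sqrt_tendsto_0:
  assumes int: "integrable M (\<lambda>u. u\<^sup>2)"
  shows "(\<lambda>N. real N * tail M (sqrt N)) \<longlonglongrightarrow> 0"
proof -
  have lim: "(\<lambda>N. \<integral>u. u\<^sup>2 * indicator {sqrt N<..} u \<partial>M) \<longlonglongrightarrow> (\<integral>u. 0 \<partial>M)"
  proof (rule integral_dominated_convergence[where w="\<lambda>u. u\<^sup>2"])
    show "AE u in M. (\<lambda>N. u\<^sup>2 * indicator {sqrt (real N)<..} u) \<longlonglongrightarrow> 0"
    proof (intro AE_I2 tendsto_eventually)
      fix u :: real
      have "eventually (\<lambda>N. real N \<ge> u\<^sup>2) sequentially" by real_asymp
      then show "\<forall>\<^sub>F N in sequentially. u\<^sup>2 * indicator {sqrt (real N)<..} u = 0"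
      proof eventually_elim
        case (elim N)
        then have "u \<le> sqrt N" by (rule real_le_rsqrt)
        then show ?case by simp
      qed
    qed
  qed (use int in \<open>auto simp: indicator_def\<close>)
  show ?thesis
  proof (rule tendsto_sandwich[OF _ _ tendsto_const])
    show "(\<lambda>N. \<integral>u. u\<^sup>2 * indicator {sqrt N<..} u \<partial>M) \<longlonglongrightarrow> 0" using lim by simp
    show "\<forall>\<^sub>F N in sequentially. real N * tail M (sqrt N) \<le> (\<integral>u. u\<^sup>2 * indicator {sqrt N<..} u \<partial>M)"
      using mult_tail_le_second_moment[OF int, of "sqrt (real _)"] by simp
  qed (simp add: tail_nonneg)
qed

text \<open>A convex function is continuous on the open half-line, so the tail has no jumps beyond
  \<open>x0\<close>. As the second moment drives it to 0, the intermediate value theorem gives exact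
  quantiles.\<close>

lemma tail_attains:
  assumes conv: "convex_on {x0..} (\<lambda>x. tail M x powr \<gamma>)" and \<gamma>: "\<gamma> > 0"
    and int: "integrable M (\<lambda>u. u\<^sup>2)"
    and x: "0 < x0" "x0 < x2" and p: "0 < p" "p < tail M x2"
  shows "\<exists>q\<ge>x2. tail M q = p"
proof -
  let ?g = "\<lambda>x. tail M x powr \<gamma>"
  let ?m = "\<integral>u. u\<^sup>2 \<partial>M"
  have "convex_on {x0<..} ?g"
    using conv by (rule convex_on_subset) (auto simp: convex_real_interval)
  then have cont: "continuous_on {x0<..} ?g" by (intro convex_on_continuous) auto
  \<comment> \<open>Far enough out that the second-moment bound on the tail drops to
    \<open>p\<close>.\<close>
  define y where "y = max x2 (sqrt (?m / p))"
  have y0: "y > 0" using x by (auto simp: y_def)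
  have "?m / p \<le> y\<^sup>2"
    by (rule sqrt_le_D) (simp add: y_def)
  then have "?m / y\<^sup>2 \<le> p" using y0 p by (simp add: field_simps)
  with tail_le_second_moment[OF int y0] have "tail M y \<le> p" by simp
  then have "?g y \<le> p powr \<gamma>" using \<gamma> by (intro powr_mono2) (auto simp: tail_nonneg)
  moreover have "p powr \<gamma> \<le> ?g x2" using \<gamma> p by (intro powr_mono2) auto
  moreover have "x2 \<le> y" by (simp add: y_def)
  moreover have "continuous_on {x2..y} ?g"
    using x by (intro continuous_on_subset[OF cont]) auto
  ultimately obtain q where q: "x2 \<le> q" "q \<le> y" "?g q = p powr \<gamma>"
    using IVT2'[of ?g y "p powr \<gamma>" x2] by auto
  have "tail M q = (?g q) powr (1/\<gamma>)" using \<gamma> by (simp add: powr_powr tail_nonneg)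
  also have "\<dots> = p" unfolding q(3) using \<gamma> p by (simp add: powr_powr)
  finally show ?thesis using q by blast
qed

text \<open>The chord of the convex function from \<open>l * x\<close> to \<open>x\<close> bounds
  its growth just left of \<open>x\<close>. At \<open>l * x\<close> the second moment bounds it by K
  / (x^2)^\<gamma>. A step of relative size (x^2 / N)^\<gamma> therefore raises it by only
  O(N^-\<gamma>), that is, raises (N Q)^\<gamma> by a small constant. Uniform continuity of the
  power 1/\<gamma> then controls N Q itself.\<close>

lemma prob_below_large_value_le:
  assumes conv: "convex_on {x0..} (\<lambda>x. tail M x powr \<gamma>)" and \<gamma>: "\<gamma> > 0"
    and int: "integrable M (\<lambda>u. u\<^sup>2)"
    and x: "0 < x0" "x0 < x2" and "0 \<le> A" "0 < \<eta>"
  shows "\<exists>\<kappa>>0. \<forall>N::nat. \<forall>x. N > 0 \<longrightarrow> x \<ge> x2 \<longrightarrow> x\<^sup>2 \<le> N \<longrightarrow> tail M x \<le> A / N \<longrightarrow>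
           prob {x - \<kappa> * (x\<^sup>2 / N) powr \<gamma> * x <..x} \<le> \<eta> / N"
proof -
  let ?g = "\<lambda>x. tail M x powr \<gamma>"
  define m where "m = (\<integral>u. u\<^sup>2 \<partial>M)"
  have m0: "m \<ge> 0" by (simp add: m_def)
  \<comment> \<open>With this ratio, \<open>x \<ge> x2\<close> gives \<open>l * x \<ge> x0\<close>,
    so the chord stays where convexity is assumed.\<close>
  define l where "l = x0 / x2"
  have l: "0 < l" "l < 1" using x by (auto simp: l_def)
  define K where "K = (m / l\<^sup>2) powr \<gamma>"
  have K0: "K \<ge> 0" by (simp add: K_def)
  let ?f = "\<lambda>z::real. z powr (1 / \<gamma>)"
  have f: "?f (y powr \<gamma>) = y" if "y \<ge> 0" for y using that \<gamma> by (simp add: powr_powr)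
  have "continuous_on {0..A powr \<gamma> + 1} ?f"
    using \<gamma> by (intro continuous_on_powr' continuous_intros) auto
  then have "uniformly_continuous_on {0..A powr \<gamma> + 1} ?f"
    by (intro compact_uniformly_continuous) auto
  from this \<open>0 < \<eta>\<close> obtain d where d: "d > 0"
    "\<And>z z'. z \<in> {0..A powr \<gamma> + 1} \<Longrightarrow> z' \<in> {0..A powr \<gamma> + 1} \<Longrightarrow> dist z' z < d \<Longrightarrow> dist (?f z') (?f z) < \<eta>"
    unfolding uniformly_continuous_on_def by metis
  \<comment> \<open>\<open>c \<le> 1\<close> keeps the chord parameter \<open>t\<close> in [0,1];
    \<open>c * K \<le> 1\<close> keeps the perturbed argument in the compact interval above;
    \<open>c * K < d\<close> is what uniform continuity asks for. The \<open>+ 1\<close> covers K =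
    0.\<close>
  define c where "c = min 1 (min 1 (d/2) / (K + 1))"
  have c: "0 < c" "c \<le> 1" "c * K \<le> 1" "c * K < d"
  proof -
    show "0 < c" "c \<le> 1" using d(1) K0 by (auto simp: c_def)
    have "c * K \<le> c * (K + 1)" using \<open>0 < c\<close> by simp
    also have "c \<le> min 1 (d/2) / (K + 1)" by (simp add: c_def)
    then have "c * (K + 1) \<le> min 1 (d/2)" using K0 by (simp add: pos_le_divide_eq)
    finally show "c * K \<le> 1" "c * K < d" using d(1) by auto
  qed
  define \<kappa> where "\<kappa> = c * (1 - l)"
  have bound: "prob {x - \<kappa> * (x\<^sup>2 / N) powr \<gamma> * x <..x} \<le> \<eta> / N"
    if N: "N > 0" and x2: "x \<ge> x2" and xN: "x\<^sup>2 \<le> N" and tx: "tail M x \<le> A / N" for N :: nat and x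
  proof -
    have x0: "x > 0" using x x2 by simp
    \<comment> \<open>The left endpoint of the interval is (1 - t) x + t l x, at distance t (1 - l)
      x from \<open>x\<close>; this explains the factor \<open>1 - l\<close> in
      \<open>\<kappa>\<close>.\<close>
    define t where "t = c * (x\<^sup>2 / N) powr \<gamma>"
    have "(x\<^sup>2 / N) powr \<gamma> \<le> 1" using N xN \<gamma> by (intro powr_le1) auto
    with c have t: "0 \<le> t" "t \<le> 1" by (auto simp: t_def intro: mult_le_one)
    define y where "y = x - \<kappa> * (x\<^sup>2 / N) powr \<gamma> * x"
    have y_eq: "y = (1 - t) * x + t * (l * x)" by (simp add: y_def \<kappa>_def t_def algebra_simps)
    have "x2 * l \<le> x * l" using l x2 by simp
    then have lx: "x0 \<le> l * x" using x by (simp add: l_def mult.commute)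
    have "?g y \<le> (1 - t) * ?g x + t * ?g (l * x)"
      unfolding y_eq using convex_onD[OF conv t, of x "l * x"] x x2 lx by simp
    also have "\<dots> \<le> ?g x + t * ?g (l * x)" using t by (simp add: algebra_simps)
    also have "t * ?g (l * x) \<le> t * (m / (l * x)\<^sup>2) powr \<gamma>"
      using t \<gamma> l x0 tail_le_second_moment[OF int, of "l * x"]
      by (intro mult_left_mono powr_mono2) (auto simp: m_def tail_nonneg)
    also have "(m / (l * x)\<^sup>2) = (m / l\<^sup>2) / x\<^sup>2" by (simp add: power_mult_distrib)
    also have "t * ((m / l\<^sup>2) / x\<^sup>2) powr \<gamma> = c * K / real N powr \<gamma>"
      using x0 m0 l N by (simp add: t_def K_def powr_divide powr_mult)
    finally have gy: "?g y \<le> ?g x + c * K / real N powr \<gamma>" by simp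
    have Npow: "real N powr \<gamma> > 0" using N by simp
    have sc: "(N * tail M w) powr \<gamma> = real N powr \<gamma> * ?g w" for w
      by (simp add: powr_mult tail_nonneg)
    let ?z = "(N * tail M x) powr \<gamma>"
    have "N * tail M x \<le> A" using tx N by (simp add: field_simps)
    then have z: "0 \<le> ?z" "?z \<le> A powr \<gamma>" using \<gamma> by (auto intro!: powr_mono2 simp: tail_nonneg)
    have zy: "(N * tail M y) powr \<gamma> \<le> ?z + c * K"
      unfolding sc using mult_left_mono[OF gy less_imp_le[OF Npow]] Npow by (simp add: distrib_left)
    have "N * tail M y = ?f ((N * tail M y) powr \<gamma>)" by (simp only: f tail_nonneg mult_nonneg_nonneg of_nat_0_le_iff)
    also have "\<dots> \<le> ?f (?z + c * K)" using zy \<gamma> by (intro powr_mono2) auto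
    also have "\<dots> \<le> ?f ?z + \<eta>"
    proof -
      have "dist (?f (?z + c * K)) (?f ?z) < \<eta>"
        using z c K0 by (intro d(2)) (auto simp: dist_real_def)
      then show ?thesis by (auto simp: dist_real_def)
    qed
    also have "?f ?z = N * tail M x" by (simp only: f tail_nonneg mult_nonneg_nonneg of_nat_0_le_iff)
    finally have "N * (tail M y - tail M x) \<le> \<eta>" by (simp add: algebra_simps)
    moreover have "y \<le> x" using c l x0 by (simp add: y_def \<kappa>_def)
    ultimately show ?thesis using N unfolding y_def[symmetric]
      by (simp add: prob_Ioc_eq_tail_diff field_simps)
  qed
  have "\<kappa> > 0" using c l by (simp add: \<kappa>_def)
  then show ?thesis by (intro exI[of _ \<kappa>] conjI allI impI bound) simp_all
qed

text \<open>Some support point lies strictly to the right of \<open>x\<close>, and a small ball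
  around it still lies beyond \<open>x\<close> and has positive mass.\<close>

lemma exists_gt_tail_pos:
  assumes "x \<in> interior (dist_support M)"
  shows "\<exists>y>x. tail M y > 0"
proof -
  obtain e where e: "e > 0" "ball x e \<subseteq> dist_support M"
    using assms by (auto simp: mem_interior)
  have "x + e/2 \<in> dist_support M" using e by (auto simp: dist_real_def)
  then have "0 < prob (ball (x + e/2) (e/4))" using e by (simp add: dist_support_def)
  also have "\<dots> \<le> tail M (x + e/4)"
    unfolding tail_def by (intro finite_measure_mono) (auto simp: dist_real_def abs_if split: if_splits)
  finally show ?thesis using e by (intro exI[of _ "x + e/4"]) auto
qed

subsection \<open>Independent samples\<close>

lemma component_measurable:
  "i \<in> I \<Longrightarrow> (\<lambda>u. u i) \<in> borel_measurable (PiM I (\<lambda>_. M))"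
  using measurable_component_singleton[of i I "\<lambda>_. M"] by (simp add: measurable_cong_sets[OF refl events_eq_borel])

lemma product_prob_space_const: "product_prob_space (\<lambda>_. M)"
  by unfold_locales

lemma prob_component:
  assumes "i \<in> I" "B \<in> sets borel"
  shows "measure (PiM I (\<lambda>_. M)) {u \<in> space (PiM I (\<lambda>_. M)). u i \<in> B} = prob B"
proof -
  interpret P: product_prob_space "\<lambda>_. M" I by (rule product_prob_space_const)
  show ?thesis using P.emeasure_PiM_Collect_single[of i B] assms by (simp add: measure_def)
qed

lemma prob_all_components:
  assumes "finite I" "B \<in> sets borel"
  shows "measure (PiM I (\<lambda>_. M)) {u \<in> space (PiM I (\<lambda>_. M)). \<forall>i\<in>I. u i \<in> B} = prob B ^ card I"
proof -
  interpret P: product_prob_space "\<lambda>_. M" I by (rule product_prob_space_const)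
  have "emeasure (PiM I (\<lambda>_. M)) {u \<in> space (PiM I (\<lambda>_. M)). \<forall>i\<in>I. u i \<in> B} = ennreal (prob B ^ card I)"
    using P.emeasure_PiM_Collect[of I "\<lambda>_. B"] assms by (simp add: emeasure_eq_measure ennreal_power)
  then show ?thesis by (simp add: measure_def)
qed

lemma prob_some_component_le:
  assumes "finite I" "B \<in> sets borel"
  shows "measure (PiM I (\<lambda>_. M)) {u \<in> space (PiM I (\<lambda>_. M)). \<exists>i\<in>I. u i \<in> B} \<le> card I * prob B"
proof -
  interpret P: product_prob_space "\<lambda>_. M" I by (rule product_prob_space_const)
  have "{u \<in> space (PiM I (\<lambda>_. M)). \<exists>i\<in>I. u i \<in> B} = (\<Union>i\<in>I. {u \<in> space (PiM I (\<lambda>_. M)). u i \<in> B})"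
    by auto
  also have "measure (PiM I (\<lambda>_. M)) \<dots> \<le> (\<Sum>i\<in>I. measure (PiM I (\<lambda>_. M)) {u \<in> space (PiM I (\<lambda>_. M)). u i \<in> B})"
    using assms by (intro P.finite_measure_subadditive_finite)
      (auto intro!: measurable_sets_Collect[OF component_measurable])
  also have "\<dots> = card I * prob B" using assms by (simp add: prob_component)
  finally show ?thesis .
qed

section \<open>Close pairs and the number of large sample values\<close>

lemma close_pair_sets:
  assumes "i \<in> I" "j \<in> I" and [measurable]: "S \<in> sets borel" and d: "d \<in> borel_measurable borel"
  shows "{u \<in> space (PiM I (\<lambda>_. M)). u i \<in> S \<and> u i - d (u i) < u j \<and> u j \<le> u i} \<in> sets (PiM I (\<lambda>_. M))"
proof -
  have m: "(\<lambda>u. u i) \<in> borel_measurable (PiM I (\<lambda>_. M))" "(\<lambda>u. u j) \<in> borel_measurable (PiM I (\<lambda>_. M))"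
    using assms by (auto intro: component_measurable)
  have "(\<lambda>u. d (u i)) \<in> borel_measurable (PiM I (\<lambda>_. M))"
    using m(1) d by (rule measurable_compose)
  with m show ?thesis
    by (intro sets.sets_Collect_conj borel_measurable_less borel_measurable_le borel_measurable_diff
        measurable_sets_Collect[OF m(1)]) auto
qed

text \<open>Integrate out coordinate \<open>j\<close> first: given \<open>u i\<close> in
  \<open>S\<close>, the half-open interval below it has mass at most \<open>c\<close>. Integrating
  over \<open>u i\<close> then yields the factor \<open>prob S\<close>.\<close>

lemma prob_pair_le:
  assumes I: "finite I" "i \<in> I" "j \<in> I" "i \<noteq> j" and [measurable]: "S \<in> sets borel" "d \<in> borel_measurable borel"
    and le: "\<And>x. x \<in> S \<Longrightarrow> prob {x - d x<..x} \<le> c"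
  shows "measure (PiM I (\<lambda>_. M)) {u \<in> space (PiM I (\<lambda>_. M)). u i \<in> S \<and> u i - d (u i) < u j \<and> u j \<le> u i} \<le> prob S * c"
proof -
  interpret P: product_prob_space "\<lambda>_. M" I by (rule product_prob_space_const)
  define J where "J = I - {j}"
  interpret J: product_prob_space "\<lambda>_. M" J by (rule product_prob_space_const)
  have J: "finite J" "j \<notin> J" "i \<in> J" "I = insert j J" using I by (auto simp: J_def)
  let ?P = "PiM I (\<lambda>_. M)"
  let ?E = "{u \<in> space ?P. u i \<in> S \<and> u i - d (u i) < u j \<and> u j \<le> u i}"
  have E: "?E \<in> sets ?P" using I by (intro close_pair_sets) auto
  show ?thesis
  proof (cases "S = {}")
    case True then show ?thesis by simp
  next
    case False
    then obtain s where "s \<in> S" by blast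
    from le[OF this] have c0: "0 \<le> c" by (rule order_trans[OF measure_nonneg])
    have "emeasure ?P ?E = (\<integral>\<^sup>+u. indicator ?E u \<partial>?P)"
      using E by simp
    also have "\<dots> = (\<integral>\<^sup>+x. (\<integral>\<^sup>+y. indicator ?E (x(j := y)) \<partial>M) \<partial>PiM J (\<lambda>_. M))"
      using E J(1,2) unfolding J(4) by (intro P.product_nn_integral_insert) auto
    also have "\<dots> \<le> (\<integral>\<^sup>+x. ennreal c * indicator {x \<in> space (PiM J (\<lambda>_. M)). x i \<in> S} x \<partial>PiM J (\<lambda>_. M))"
    proof (rule nn_integral_mono)
      fix x assume x: "x \<in> space (PiM J (\<lambda>_. M))"
      have "(\<integral>\<^sup>+y. indicator ?E (x(j := y)) \<partial>M) \<le> (\<integral>\<^sup>+y. indicator S (x i) * indicator {x i - d (x i)<..x i} y \<partial>M)"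
        using I by (intro nn_integral_mono) (auto simp: indicator_def)
      also have "\<dots> = indicator S (x i) * ennreal (prob {x i - d (x i)<..x i})"
        by (simp add: nn_integral_cmult emeasure_eq_measure)
      also have "\<dots> \<le> indicator S (x i) * ennreal c"
        using le by (auto simp: indicator_def intro: ennreal_leI)
      also have "\<dots> = ennreal c * indicator {x \<in> space (PiM J (\<lambda>_. M)). x i \<in> S} x"
        using x by (simp add: indicator_def)
      finally show "(\<integral>\<^sup>+y. indicator ?E (x(j := y)) \<partial>M) \<le> ennreal c * indicator {x \<in> space (PiM J (\<lambda>_. M)). x i \<in> S} x" .
    qed
    also have "\<dots> = ennreal c * emeasure (PiM J (\<lambda>_. M)) {x \<in> space (PiM J (\<lambda>_. M)). x i \<in> S}"
    proof -
      have [measurable]: "(\<lambda>u. u i) \<in> borel_measurable (PiM J (\<lambda>_. M))" using J by (auto intro: component_measurable)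
      show ?thesis by (subst nn_integral_cmult_indicator) auto
    qed
    also have "\<dots> = ennreal (prob S * c)"
      using J prob_component[of i J S] c0
      by (simp add: J.P.emeasure_eq_measure ennreal_mult[symmetric] mult.commute)
    finally show ?thesis
      using c0 by (simp add: P.P.emeasure_eq_measure)
  qed
qed

text \<open>Exponential Markov inequality: exp(-count) is a product of independent factors with
  common mean \<open>r\<close>, and \<open>r < 1\<close> because values above \<open>a\<close> have
  positive probability.\<close>

lemma prob_few_large_tendsto_0:
  assumes "tail M a > 0"
  shows "\<exists>c>0. (\<lambda>N. measure (PiM {1..N} (\<lambda>_. M))
     {u \<in> space (PiM {1..N} (\<lambda>_. M)). real (card {j\<in>{1..N}. u j > a}) < c * real N}) \<longlonglongrightarrow> 0"
proof -
  define h :: "real \<Rightarrow> real" where "h = (\<lambda>y. exp (- indicator {a<..} y))"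
  have [measurable]: "h \<in> borel_measurable borel" unfolding h_def by measurable
  have inth: "integrable M h"
    by (rule integrable_const_bound[where B=1]) (auto simp: h_def)
  define r where "r = (\<integral>y. h y \<partial>M)"
  have "h = (\<lambda>y. 1 - (1 - exp (-1)) * indicator {a<..} y)"
    by (auto simp: h_def indicator_def)
  then have r: "r = 1 - (1 - exp (-1)) * tail M a"
    unfolding r_def
    by (simp only:, subst Bochner_Integration.integral_diff) (auto simp: tail_def prob_space[simplified] emeasure_eq_measure intro: integrable_real_indicator)
  have "r < 1" unfolding r using assms by simp
  have "r > 0"
  proof -
    define e :: real where "e = 1 - exp (-1)"
    have e: "0 < e" "e < 1" by (auto simp: e_def)
    have "e * tail M a \<le> e * 1" using e by (intro mult_left_mono) (auto simp: tail_def)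
    then show ?thesis unfolding r e_def[symmetric] using e by linarith
  qed
  \<comment> \<open>Then r = exp(-2c), so r^N divided by the threshold exp(-cN) still decays like
    exp(-cN).\<close>
  define c where "c = - ln r / 2"
  have c0: "c > 0" using \<open>r < 1\<close> \<open>r > 0\<close> by (simp add: c_def)
  have bound: "measure (PiM {1..N} (\<lambda>_. M))
     {u \<in> space (PiM {1..N} (\<lambda>_. M)). real (card {j\<in>{1..N}. u j > a}) < c * real N} \<le> exp (-c) ^ N" for N
  proof -
    let ?P = "PiM {1..N} (\<lambda>_. M)"
    interpret P: product_prob_space "\<lambda>_. M" "{1..N}" by (rule product_prob_space_const)
    let ?F = "\<lambda>u. \<Prod>j\<in>{1..N}. h (u j)"
    have F: "?F u = exp (- real (card {j\<in>{1..N}. u j > a}))" for u :: "nat \<Rightarrow> real"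
    proof -
      have "?F u = exp (- (\<Sum>j\<in>{1..N}. indicator {a<..} (u j)))"
        by (simp add: h_def exp_sum sum_negf[symmetric])
      also have "(\<Sum>j\<in>{1..N}. indicator {a<..} (u j)) = real (card {j\<in>{1..N}. u j > a})"
        by (simp add: indicator_def sum.If_cases Int_def)
      finally show ?thesis .
    qed
    have [measurable]: "?F \<in> borel_measurable ?P"
      by (intro borel_measurable_prod measurable_compose[OF component_measurable]) auto
    have "measure ?P {u \<in> space ?P. real (card {j\<in>{1..N}. u j > a}) < c * real N}
       \<le> measure ?P {u \<in> space ?P. exp (- (c * real N)) \<le> ?F u}"
    proof (rule P.P.finite_measure_mono)
      show "{u \<in> space ?P. exp (- (c * real N)) \<le> ?F u} \<in> sets ?P" by measurable
    qed (auto simp: F[simplified])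
    also have "\<dots> \<le> (\<integral>u. ?F u \<partial>?P) / exp (- (c * real N))"
    proof (rule integral_Markov_inequality_measure)
      show "integrable ?P ?F"
        by (rule P.P.integrable_const_bound[where B=1]) (auto simp: F[simplified])
    qed (auto simp: F[simplified])
    also have "(\<integral>u. ?F u \<partial>?P) = r ^ N"
      using P.product_integral_prod[of "{1..N}" "\<lambda>_. h"] inth by (simp add: r_def)
    also have "r = exp (-c) ^ 2" using \<open>r > 0\<close> by (simp add: c_def exp_double[symmetric])
    also have "(exp (-c) ^ 2) ^ N / exp (- (c * real N)) = exp (-c) ^ N"
      by (simp add: exp_of_nat_mult[symmetric] exp_diff[symmetric] field_simps)
    finally show ?thesis .
  qed
  have lim: "(\<lambda>N. exp (-c) ^ N) \<longlonglongrightarrow> 0" using c0 by (intro LIMSEQ_power_zero) simp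
  show ?thesis
  proof (intro exI[of _ c] conjI c0 tendsto_sandwich[OF _ _ tendsto_const lim] always_eventually allI)
    fix N
    show "0 \<le> measure (PiM {1..N} (\<lambda>_. M))
     {u \<in> space (PiM {1..N} (\<lambda>_. M)). real (card {j\<in>{1..N}. u j > a}) < c * real N}"
      by (rule measure_nonneg)
  qed (rule bound)
qed

lemma exists_component_sets:
  "finite I \<Longrightarrow> B \<in> sets borel \<Longrightarrow> {u \<in> space (PiM I (\<lambda>_. M)). \<exists>i\<in>I. u i \<in> B} \<in> sets (PiM I (\<lambda>_. M))"
  by (intro sets.sets_Collect_finite_Ex) (auto intro!: measurable_sets_Collect[OF component_measurable])

text \<open>Union bound over ordered pairs. It is effective when both \<open>prob S\<close> and
  \<open>c\<close> are of order 1/N, since their product then compensates the number of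
  pairs.\<close>

lemma prob_close_pair_le:
  assumes I: "finite I" and [measurable]: "S \<in> sets borel" "d \<in> borel_measurable borel"
    and le: "\<And>x. x \<in> S \<Longrightarrow> prob {x - d x<..x} \<le> c" and c: "0 \<le> c"
  shows "{u \<in> space (PiM I (\<lambda>_. M)). \<exists>i\<in>I. \<exists>j\<in>I. i \<noteq> j \<and> u i \<in> S \<and> u i - d (u i) < u j \<and> u j \<le> u i}
           \<in> sets (PiM I (\<lambda>_. M))" (is "?E \<in> sets ?P")
    and "measure (PiM I (\<lambda>_. M)) {u \<in> space (PiM I (\<lambda>_. M)). \<exists>i\<in>I. \<exists>j\<in>I. i \<noteq> j \<and> u i \<in> S \<and> u i - d (u i) < u j \<and> u j \<le> u i}
           \<le> (real (card I))\<^sup>2 * (prob S * c)"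
proof -
  interpret P: product_prob_space "\<lambda>_. M" I by (rule product_prob_space_const)
  let ?e = "\<lambda>(i,j). {u \<in> space ?P. u i \<in> S \<and> u i - d (u i) < u j \<and> u j \<le> u i}"
  let ?I = "{(i,j). i \<in> I \<and> j \<in> I \<and> i \<noteq> j}"
  have sub: "?I \<subseteq> I \<times> I" by auto
  have finI: "finite ?I" using I by (intro finite_subset[OF sub]) auto
  have E: "?E = (\<Union>p\<in>?I. ?e p)" by auto
  have e: "?e (i,j) \<in> sets ?P" if ij: "i \<in> I" "j \<in> I" for i j
    using ij by (simp only: case_prod_conv, intro close_pair_sets) auto
  show "?E \<in> sets ?P" unfolding E using finI e by (intro sets.finite_UN) auto
  have "measure ?P ?E \<le> (\<Sum>p\<in>?I. measure ?P (?e p))"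
    unfolding E using finI e by (intro P.P.finite_measure_subadditive_finite) auto
  also have "\<dots> \<le> (\<Sum>p\<in>?I. prob S * c)"
    using I le by (intro sum_mono) (auto intro!: prob_pair_le)
  also have "\<dots> = real (card ?I) * (prob S * c)" by simp
  also have "\<dots> \<le> real (card (I \<times> I)) * (prob S * c)"
    using c I card_mono[OF _ sub] by (intro mult_right_mono of_nat_mono) auto
  also have "real (card (I \<times> I)) = (real (card I))\<^sup>2" by (simp add: card_cartesian_product power2_eq_square)
  finally show "measure ?P ?E \<le> (real (card I))\<^sup>2 * (prob S * c)" .
qed

section \<open>Annealed probabilities\<close>

lemma integrable_prob_tournament:
  "integrable (PiM {1..N} (\<lambda>_. M)) (\<lambda>u. measure_pmf.prob (tournament N (order_stat N u)) A)"
proof -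
  interpret P: product_prob_space "\<lambda>_. M" "{1..N}" by (rule product_prob_space_const)
  show ?thesis
    by (rule P.P.integrable_const_bound[where B=1])
       (auto intro: prob_tournament_measurable[OF events_eq_borel] simp del: One_nat_def)
qed

lemma annealed_mono:
  assumes "\<And>x. E x \<Longrightarrow> E' x"
  shows "annealed M N E \<le> annealed M N E'"
  unfolding annealed_def
  by (intro integral_mono integrable_prob_tournament measure_pmf.finite_measure_mono) (use assms in auto)

lemma annealed_le_1: "annealed M N E \<le> 1"
proof -
  interpret P: product_prob_space "\<lambda>_. M" "{1..N}" by (rule product_prob_space_const)
  show ?thesis unfolding annealed_def
    by (rule P.P.integral_le_const[OF integrable_prob_tournament]) auto
qed

text \<open>The conditional probability is at least 1 - t off \<open>B\<close> and at least 0 on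
  \<open>B\<close>, hence everywhere at least 1 - t minus the indicator of \<open>B\<close>.\<close>

lemma annealed_ge:
  assumes B: "B \<in> sets (PiM {1..N} (\<lambda>_. M))" "measure (PiM {1..N} (\<lambda>_. M)) B \<le> b"
    and t: "0 \<le> t" "t \<le> 1"
    and good: "\<And>u. u \<in> space (PiM {1..N} (\<lambda>_. M)) \<Longrightarrow> u \<notin> B \<Longrightarrow>
       measure_pmf.prob (tournament N (order_stat N u)) {x. E x} \<ge> 1 - t"
  shows "annealed M N E \<ge> 1 - t - b"
proof -
  let ?P = "PiM {1..N} (\<lambda>_. M)"
  interpret P: product_prob_space "\<lambda>_. M" "{1..N}" by (rule product_prob_space_const)
  have "1 - t - b \<le> 1 - t - measure ?P B" using B by simp
  also have "\<dots> = (\<integral>u. (1 - t) - indicator B u \<partial>?P)"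
    using B by (subst Bochner_Integration.integral_diff)
      (auto simp: P.P.prob_space P.P.emeasure_eq_measure intro: integrable_real_indicator simp del: One_nat_def)
  also have "\<dots> \<le> annealed M N E" unfolding annealed_def
  proof (rule integral_mono)
    show "integrable ?P (\<lambda>u. (1 - t) - indicator B u)"
      using B by (auto simp: P.P.emeasure_eq_measure intro!: Bochner_Integration.integrable_diff integrable_real_indicator
          simp del: One_nat_def)
    fix u assume u: "u \<in> space ?P"
    show "(1 - t) - indicator B u \<le> measure_pmf.prob (tournament N (order_stat N u)) {x. E x}"
    proof (cases "u \<in> B")
      case True
      have "0 \<le> measure_pmf.prob (tournament N (order_stat N u)) {x. E x}" by simp
      with True t show ?thesis by (smt (verit) indicator_simps(1))
    next
      case False
      with good[OF u] show ?thesis by simp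
    qed
  qed (rule integrable_prob_tournament)
  finally show ?thesis .
qed

end

subsection \<open>The strongest player wins\<close>

text \<open>The right side equals N^(1 - 2\<gamma>) x^(4\<gamma> - 1). If 4\<gamma> is at least 1
  the worst case is x = \<open>x2\<close>, and \<gamma> < 1/2 leaves a positive power of N.
  Otherwise the worst case is x = sqrt(N), where the value is exactly sqrt(N).\<close>

lemma exponent_lower_bound:
  fixes \<gamma> x2 :: real
  assumes \<gamma>: "0 < \<gamma>" "\<gamma> < 1/2" and x2: "0 < x2"
  shows "\<exists>K>0. \<exists>\<rho>>0. \<forall>N::nat. \<forall>x\<ge>x2. 0 < N \<longrightarrow> x\<^sup>2 \<le> real N \<longrightarrow>
           K * real N powr \<rho> \<le> real N * ((x\<^sup>2 / real N) powr \<gamma>)\<^sup>2 / x"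
proof -
  have eq: "real N * ((x\<^sup>2 / real N) powr \<gamma>)\<^sup>2 / x = real N powr (1 - 2 * \<gamma>) * x powr (4 * \<gamma> - 1)"
    if "x > 0" "N > 0" for x and N :: nat
  proof -
    have "((x\<^sup>2 / real N) powr \<gamma>)\<^sup>2 = (x\<^sup>2 / real N) powr (2 * \<gamma>)"
      using that by (simp add: powr_powr power2_eq_square powr_add[symmetric])
    also have "\<dots> = x powr (4 * \<gamma>) / real N powr (2 * \<gamma>)"
      using that by (simp add: powr_divide powr_powr flip: powr_numeral)
    finally show ?thesis using that by (simp add: powr_diff)
  qed
  show ?thesis
  proof (cases "4 * \<gamma> \<ge> 1")
    case True
    have "x2 powr (4 * \<gamma> - 1) * real N powr (1 - 2 * \<gamma>) \<le> real N * ((x\<^sup>2 / real N) powr \<gamma>)\<^sup>2 / x"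
      if "x \<ge> x2" "0 < N" for N :: nat and x
      using that x2 True by (subst eq) (auto simp: mult.commute intro!: mult_right_mono powr_mono2)
    then show ?thesis using \<gamma> x2
      by (intro exI[of _ "x2 powr (4 * \<gamma> - 1)"] exI[of _ "1 - 2 * \<gamma>"] conjI allI impI) auto
  next
    case False
    have "1 * real N powr (1/2) \<le> real N * ((x\<^sup>2 / real N) powr \<gamma>)\<^sup>2 / x"
      if x: "x \<ge> x2" "0 < N" "x\<^sup>2 \<le> real N" for N :: nat and x
    proof -
      have x0: "x > 0" using x x2 by simp
      have xs: "x \<le> real N powr (1/2)" using x by (simp add: powr_half_sqrt real_le_rsqrt)
      have "real N powr (1/2) = real N powr ((1 - 2 * \<gamma>) + 1/2 * (4 * \<gamma> - 1))"
        by (simp add: field_simps)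
      also have "\<dots> = real N powr (1 - 2 * \<gamma>) * (real N powr (1/2)) powr (4 * \<gamma> - 1)"
        by (simp only: powr_powr powr_add)
      also have "\<dots> \<le> real N powr (1 - 2 * \<gamma>) * x powr (4 * \<gamma> - 1)"
        using xs x0 False by (intro mult_left_mono powr_mono2') auto
      finally show ?thesis using x x0 by (subst eq) auto
    qed
    then show ?thesis
      by (intro exI[of _ "1::real"] exI[of _ "1/2::real"] conjI allI impI) auto
  qed
qed

lemma nat_mult_exp_neg_powr_tendsto_0:
  fixes c \<rho> :: real
  assumes "c > 0" "\<rho> > 0"
  shows "(\<lambda>N::nat. real N * exp (- (c * real N powr \<rho>))) \<longlonglongrightarrow> 0"
  using assms by real_asymp

context real_distribution
begin

lemma strongest_wins_eventually:
  assumes pos: "AE u in M. u > 0"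
    and int: "integrable M (\<lambda>u. u\<^sup>2)"
    and \<gamma>: "0 < \<gamma>" "\<gamma> < 1/2"
    and conv: "convex_on {x0..} (\<lambda>x. tail M x powr \<gamma>)"
    and x: "0 < x0" "x0 < x2" and tail: "tail M x2 > 0"
    and \<epsilon>: "0 < \<epsilon>" "\<epsilon> < 1"
  shows "\<forall>\<^sub>F N in sequentially.
    annealed M N (\<lambda>x. \<forall>i\<in>{1..<N}. score N x i < score N x N) \<ge> 1 - 5 * \<epsilon>"
proof -
  \<comment> \<open>The level \<open>q\<close> chosen below is exceeded by A sample values on
    average; none exceeds it with probability (1 - A/N)^N, at most exp(-A) = \<epsilon>.\<close>
  define A where "A = - ln \<epsilon>"
  have A0: "A > 0" using \<epsilon> by (simp add: A_def)
  \<comment> \<open>Makes the close-pair bound N^2 (A/N) (\<eta>/N) equal to \<epsilon>.\<close>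
  define \<eta> where "\<eta> = \<epsilon> / A"
  have \<eta>0: "\<eta> > 0" using \<epsilon> A0 by (simp add: \<eta>_def)
  obtain \<kappa> where \<kappa>: "\<kappa> > 0" and close: "\<And>N x. N > 0 \<Longrightarrow> x \<ge> x2 \<Longrightarrow> x\<^sup>2 \<le> real N \<Longrightarrow> tail M x \<le> A / real N \<Longrightarrow>
           prob {x - \<kappa> * (x\<^sup>2 / real N) powr \<gamma> * x <..x} \<le> \<eta> / real N"
    using prob_below_large_value_le[OF conv \<gamma>(1) int x less_imp_le[OF A0] \<eta>0] by auto
  have "tail M x0 > 0" using tail tail_antimono[of x0 x2] x by simp
  then obtain c where c: "c > 0" and few: "(\<lambda>N. measure (PiM {1..N} (\<lambda>_. M))
     {u \<in> space (PiM {1..N} (\<lambda>_. M)). real (card {j\<in>{1..N}. u j > x0}) < c * real N}) \<longlonglongrightarrow> 0"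
    using prob_few_large_tendsto_0 by blast
  obtain K \<rho> where K: "K > 0" and \<rho>: "\<rho> > 0"
    and expo: "\<And>N x. x \<ge> x2 \<Longrightarrow> 0 < N \<Longrightarrow> x\<^sup>2 \<le> real N \<Longrightarrow>
           K * real N powr \<rho> \<le> real N * ((x\<^sup>2 / real N) powr \<gamma>)\<^sup>2 / x"
    using exponent_lower_bound[OF \<gamma>, of x2] x by auto
  \<comment> \<open>Collects the constants of the Chernoff exponent when a = \<open>x0\<close>, C -
    2 is replaced by its lower bound cN/2, and the gap carries the factor \<kappa>.\<close>
  define k where "k = x0 * (c / 2) * \<kappa>\<^sup>2 / 16"
  have k0: "k > 0" using x c \<kappa> by (simp add: k_def)
  have "\<forall>\<^sub>F N in sequentially. A / real N < tail M x2"
    using tail A0 by real_asymp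
  moreover have "\<forall>\<^sub>F N in sequentially. real N * tail M (sqrt N) < \<epsilon>"
    using mult_tail_sqrt_tendsto_0[OF int] \<epsilon>(1) by (rule order_tendstoD(2))
  moreover have "\<forall>\<^sub>F N in sequentially. measure (PiM {1..N} (\<lambda>_. M))
     {u \<in> space (PiM {1..N} (\<lambda>_. M)). real (card {j\<in>{1..N}. u j > x0}) < c * real N} < \<epsilon>"
    using few \<epsilon>(1) by (rule order_tendstoD(2))
  moreover have "\<forall>\<^sub>F N in sequentially. real N * exp (- (k * K * real N powr \<rho>)) < \<epsilon>"
    using nat_mult_exp_neg_powr_tendsto_0[of "k * K" \<rho>] k0 K \<rho> \<epsilon>(1) by (intro order_tendstoD(2)) auto
  moreover have "\<forall>\<^sub>F N in sequentially. c * real N - 2 \<ge> c / 2 * real N"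
    using c by real_asymp
  moreover have "\<forall>\<^sub>F N in sequentially. N \<ge> (1::nat)" by (rule eventually_ge_at_top)
  ultimately show ?thesis
  proof eventually_elim
    case (elim N)
    let ?P = "PiM {1..N} (\<lambda>_. M)"
    interpret P: product_prob_space "\<lambda>_. M" "{1..N}" by (rule product_prob_space_const)
    have N: "N > 0" using elim by simp
    obtain q where q: "x2 \<le> q" "tail M q = A / real N"
      using tail_attains[OF conv \<gamma>(1) int x _ elim(1)] A0 N by auto
    define d where "d = (\<lambda>x. \<kappa> * (x\<^sup>2 / real N) powr \<gamma> * x)"
    have d_meas: "d \<in> borel_measurable borel" unfolding d_def by measurable
    have d_prob: "prob {x - d x<..x} \<le> \<eta> / real N" if "x \<in> {q<..sqrt N}" for x
    proof -
      have "x\<^sup>2 \<le> (sqrt N)\<^sup>2" using that q x by (intro power_mono) auto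
      then show ?thesis unfolding d_def
        using that q tail_antimono[of q x] N by (intro close) auto
    qed
    \<comment> \<open>The bad events: a value above sqrt(N), no value above \<open>q\<close>, a
      close pair with upper member between \<open>q\<close> and sqrt(N), too few values above
      \<open>x0\<close>, and a nonpositive value. The last is null; the others cost at most
      \<epsilon> each.\<close>
    let ?B1 = "{u \<in> space ?P. \<exists>i\<in>{1..N}. u i \<in> {sqrt N<..}}"
    let ?B2 = "{u \<in> space ?P. \<forall>i\<in>{1..N}. u i \<in> {..q}}"
    let ?B3 = "{u \<in> space ?P. \<exists>i\<in>{1..N}. \<exists>j\<in>{1..N}. i \<noteq> j \<and> u i \<in> {q<..sqrt N} \<and> u i - d (u i) < u j \<and> u j \<le> u i}"
    let ?B4 = "{u \<in> space ?P. real (card {j\<in>{1..N}. u j > x0}) < c * real N}"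
    let ?B5 = "{u \<in> space ?P. \<exists>i\<in>{1..N}. u i \<in> {..0}}"
    have s1: "?B1 \<in> sets ?P" and s5: "?B5 \<in> sets ?P" by (rule exists_component_sets; simp)+
    have s2: "?B2 \<in> sets ?P"
      by (intro sets.sets_Collect_finite_All) (auto intro!: measurable_sets_Collect[OF component_measurable])
    have s3: "?B3 \<in> sets ?P"
      by (rule prob_close_pair_le(1)[OF _ _ d_meas d_prob]) (use \<eta>0 in auto)
    have m3: "measure ?P ?B3 \<le> (real (card {1..N}))\<^sup>2 * (prob {q<..sqrt N} * (\<eta> / real N))"
      by (rule prob_close_pair_le(2)[OF _ _ d_meas d_prob]) (use \<eta>0 in auto)
    have s4: "?B4 \<in> sets ?P"
    proof -
      have "(\<lambda>u. \<Sum>j\<in>{1..N}. indicator {x0<..} (u j) :: real) \<in> borel_measurable ?P"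
        by (intro borel_measurable_sum measurable_compose[OF component_measurable]) auto
      then have "{u \<in> space ?P. (\<Sum>j\<in>{1..N}. indicator {x0<..} (u j)) < c * real N} \<in> sets ?P"
        by (intro borel_measurable_less) auto
      moreover have "(\<Sum>j\<in>{1..N}. indicator {x0<..} (u j)) = real (card {j\<in>{1..N}. u j > x0})" for u
        by (simp add: indicator_def sum.If_cases Int_def)
      ultimately show ?thesis by (simp only:)
    qed
    have m1: "measure ?P ?B1 \<le> \<epsilon>"
      using prob_some_component_le[of "{1..N}" "{sqrt N<..}"] elim(2) by (simp add: tail_def)
    have m2: "measure ?P ?B2 \<le> \<epsilon>"
    proof -
      have "measure ?P ?B2 = (1 - A / real N) ^ N"
        using prob_all_components[of "{1..N}" "{..q}"] q by (simp add: prob_atMost_eq_tail)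
      also have "\<dots> \<le> exp (- (A / real N)) ^ N"
      proof (rule power_mono)
        show "1 - A / real N \<le> exp (- (A / real N))"
          using exp_ge_add_one_self[of "- (A / real N)"] by simp
        show "0 \<le> 1 - A / real N"
          using q(2) by (metis measure_nonneg prob_atMost_eq_tail)
      qed
      also have "\<dots> = \<epsilon>" using N \<epsilon> by (simp add: exp_of_nat_mult[symmetric] A_def)
      finally show ?thesis .
    qed
    have "prob {q<..sqrt N} \<le> tail M q" unfolding tail_def by (intro finite_measure_mono) auto
    then have "(real N)\<^sup>2 * (prob {q<..sqrt N} * (\<eta> / real N)) \<le> (real N)\<^sup>2 * (A / real N * (\<eta> / real N))"
      using q \<eta>0 by (intro mult_left_mono mult_right_mono) auto
    also have "\<dots> = \<epsilon>" using N A0 by (simp add: \<eta>_def power2_eq_square)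
    finally have m3': "measure ?P ?B3 \<le> \<epsilon>" using m3 by simp
    have "prob {..0} = 0"
    proof -
      have "AE u in M. u \<notin> {..0}" using pos by eventually_elim auto
      then show ?thesis by (subst prob_eq_0) auto
    qed
    then have m5: "measure ?P ?B5 \<le> 0"
      using prob_some_component_le[of "{1..N}" "{..0}"] by simp
    let ?B = "?B1 \<union> (?B2 \<union> (?B3 \<union> (?B4 \<union> ?B5)))"
    have sB: "?B \<in> sets ?P" using s1 s2 s3 s4 s5 by (intro sets.Un)
    have "measure ?P ?B \<le> measure ?P ?B1 + (measure ?P ?B2 + (measure ?P ?B3 + (measure ?P ?B4 + measure ?P ?B5)))"
      by (intro order_trans[OF measure_Un_le] add_left_mono sets.Un s1 s2 s3 s4 s5 order_refl)
    also have "\<dots> \<le> 4 * \<epsilon>" using m1 m2 m3' elim(3) m5 by linarith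
    finally have mB: "measure ?P ?B \<le> 4 * \<epsilon>" .
    have good: "measure_pmf.prob (tournament N (order_stat N u)) {x. \<forall>i\<in>{1..<N}. score N x i < score N x N} \<ge> 1 - \<epsilon>"
      if u: "u \<in> space ?P" "u \<notin> ?B" for u
    proof -
      define v where "v = order_stat N u"
      obtain \<pi> where \<pi>: "bij_betw \<pi> {1..N} {1..N}" and v\<pi>: "\<And>k. k \<in> {1..N} \<Longrightarrow> v k = u (\<pi> k)"
        using order_stat_bij unfolding v_def by blast
      have \<pi>in: "\<pi> k \<in> {1..N}" if "k \<in> {1..N}" for k using bij_betwE[OF \<pi>] that by blast
      have Nin: "N \<in> {1..N}" using N by simp
      have vmono: "v k \<le> v N" if "k \<in> {1..N}" for k
        using order_stat_mono[of k N N u] that by (simp add: v_def)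
      have vN_le: "v N \<le> sqrt N" using u \<pi>in[OF Nin] v\<pi>[OF Nin] by (auto simp: not_less)
      have vN_gt: "v N > q"
      proof -
        obtain i where i: "i \<in> {1..N}" "u i > q" using u by (auto simp: not_le)
        then obtain k where k: "k \<in> {1..N}" "i = \<pi> k" using bij_betw_imp_surj_on[OF \<pi>] by blast
        with i v\<pi>[OF k(1)] vmono[OF k(1)] show ?thesis by simp
      qed
      have vN0: "v N > 0" using vN_gt q x by simp
      have vpos: "v k > 0" if "k \<in> {1..N}" for k
        using u \<pi>in[OF that] v\<pi>[OF that] by (auto simp: not_le)
      \<comment> \<open>A competitor within \<open>d (v N)\<close> of the top would make the sample
        indices \<open>\<pi> N\<close> and \<open>\<pi> i\<close> a close pair. They are distinct by
        injectivity, so a tie at the top is excluded as well.\<close>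
      have gap: "v i \<le> v N - d (v N)" if i: "i \<in> {1..<N}" for i
      proof (rule ccontr)
        assume "\<not> v i \<le> v N - d (v N)"
        have i': "i \<in> {1..N}" using i by simp
        have "\<pi> i \<noteq> \<pi> N" using bij_betw_imp_inj_on[OF \<pi>] i i' Nin by (auto dest: inj_onD)
        then have "u \<in> ?B3"
          using u(1) \<pi>in[OF Nin] \<pi>in[OF i'] \<open>\<not> v i \<le> v N - d (v N)\<close> vmono[OF i'] vN_gt vN_le
          unfolding v\<pi>[OF Nin] v\<pi>[OF i']
          by (intro CollectI conjI bexI[of _ "\<pi> N"] bexI[of _ "\<pi> i"]) auto
        with u(2) show False by blast
      qed
      have "real (card {j\<in>{1..N}. v j > x0}) = real (card {j\<in>{1..N}. u j > x0})"
        unfolding v_def using card_order_stat[where P="\<lambda>y. y > x0"] by simp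
      then have big: "real (card {j\<in>{1..N}. v j > x0}) \<ge> c * real N" using u by (auto simp: not_less)
      have d0: "0 \<le> d (v N)" using \<kappa> vN0 by (simp add: d_def)
      have "1 - real N * exp (- (x0 * (c * real N - 2) * (d (v N))\<^sup>2 / (16 * v N ^ 3)))
          \<le> measure_pmf.prob (tournament N v) {x. \<forall>i\<in>{1..<N}. score N x i < score N x N}"
        using vpos elim(6) gap d0 x big by (intro prob_strongest_wins_ge) auto
      moreover have "k * K * real N powr \<rho> \<le> x0 * (c * real N - 2) * (d (v N))\<^sup>2 / (16 * v N ^ 3)"
      proof -
        have "(v N)\<^sup>2 \<le> (sqrt N)\<^sup>2" using vN_le vN0 by (intro power_mono) auto
        then have "k * (K * real N powr \<rho>) \<le> k * (real N * (((v N)\<^sup>2 / real N) powr \<gamma>)\<^sup>2 / v N)"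
          using vN_gt q N k0 by (intro mult_left_mono expo) auto
        also have "\<dots> = x0 * (c / 2 * real N) * (d (v N))\<^sup>2 / (16 * v N ^ 3)"
          using vN0 by (simp add: k_def d_def power_mult_distrib power2_eq_square power3_eq_cube)
        also have "\<dots> \<le> x0 * (c * real N - 2) * (d (v N))\<^sup>2 / (16 * v N ^ 3)"
          using elim(5) x vN0 by (intro divide_right_mono mult_right_mono mult_left_mono) auto
        finally show ?thesis by (simp add: mult.assoc)
      qed
      then have "real N * exp (- (x0 * (c * real N - 2) * (d (v N))\<^sup>2 / (16 * v N ^ 3)))
           \<le> real N * exp (- (k * K * real N powr \<rho>))"
        by (intro mult_left_mono) auto
      ultimately show ?thesis using elim(4) unfolding v_def by linarith
    qed
    \<comment> \<open>One \<epsilon> is the conditional failure probability on good samples, four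
      come from the bad events.\<close>
    have "1 - \<epsilon> - 4 * \<epsilon> \<le> annealed M N (\<lambda>x. \<forall>i\<in>{1..<N}. score N x i < score N x N)"
      by (rule annealed_ge[OF sB mB _ _ good]) (use \<epsilon> in auto)
    then show ?case by simp
  qed
qed

end

theorem theorem1:
  fixes D :: "real measure" and \<beta> x0 :: real
  assumes "prob_space D"
    and "sets D = sets borel"
    and "AE u in D. u > 0"
    and "integrable D (\<lambda>u. u\<^sup>2)"
    and "0 < \<beta>" and "\<beta> < 1/2"
    and "x0 > 0" and "x0 \<in> interior (dist_support D)"
    and "convex_on {x0..} (\<lambda>x. tail D x powr (1/2 - \<beta>))"
  shows "(\<forall>N\<ge>1. annealed D N (\<lambda>x. \<forall>i\<in>{1..N}. score N x i \<le> score N x N)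
               \<ge> annealed D N (\<lambda>x. \<forall>i\<in>{1..<N}. score N x i < score N x N))
         \<and> (\<lambda>N. annealed D N (\<lambda>x. \<forall>i\<in>{1..<N}. score N x i < score N x N))
             \<longlonglongrightarrow> 1"
proof
  interpret real_distribution D
    using assms(1,2) by (intro real_distribution.intro real_distribution_axioms.intro)
  let ?w = "\<lambda>N. annealed D N (\<lambda>x. \<forall>i\<in>{1..<N}. score N x i < score N x N)"
  show "\<forall>N\<ge>1. annealed D N (\<lambda>x. \<forall>i\<in>{1..N}. score N x i \<le> score N x N) \<ge> ?w N"
    by (intro allI impI annealed_mono) (metis atLeastAtMost_iff atLeastLessThan_iff le_neq_implies_less order.refl less_imp_le)
  obtain x2 where x2: "x2 > x0" "tail D x2 > 0"
    using exists_gt_tail_pos assms(8) by blast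
  show "?w \<longlonglongrightarrow> 1"
  proof (rule order_tendstoI)
    fix a :: real assume "a < 1"
    \<comment> \<open>Dividing by 6 makes the total loss 5\<epsilon> strictly smaller than 1 - a;
      the cap 1/2 ensures \<epsilon> < 1.\<close>
    define \<epsilon> where "\<epsilon> = min (1/2) ((1 - a) / 6)"
    have \<epsilon>: "0 < \<epsilon>" "\<epsilon> < 1" "5 * \<epsilon> < 1 - a" using \<open>a < 1\<close> by (auto simp: \<epsilon>_def min_def)
    have "\<forall>\<^sub>F N in sequentially. ?w N \<ge> 1 - 5 * \<epsilon>"
      using assms x2 \<epsilon> by (intro strongest_wins_eventually) auto
    then show "\<forall>\<^sub>F N in sequentially. a < ?w N"
      by eventually_elim (use \<epsilon>(3) in linarith)
  next
    fix a :: real assume "1 < a"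
    then show "\<forall>\<^sub>F N in sequentially. ?w N < a"
      by (intro always_eventually allI le_less_trans[OF annealed_le_1])
  qed
qed

end
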